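(* (ZFC) For every $a, b \in (0,1)$, $\clubsuit^{\sup \geq a}$ is equivalent to $\clubsuit^{\sup \geq b}$.
   Context: $\mathrm{Lim}(\omega_1)$ is the set of all countable limit ordinals. $[\omega_1]^{\aleph_1}$ is the set of uncountable subsets of $\omega_1$. For $a \in (0,1]$, the principle $\clubsuit^{\sup \geq a}$ says: there exists $\bar{A} = \langle A_\delta : \delta \in \mathrm{Lim}(\omega_1)\rangle$ such that (a) each $A_\delta = \{\alpha_{\delta,n} : n<\omega\}$ where the $\alpha_{\delta,n}$ are increasing with $n$ and cofinal in $\delta$, and (b) for every $A \in [\omega_1]^{\aleph_1}$ there exists $\delta \in \mathrm{Lim}(\omega_1)$ such that $$\limsup_n \frac{|\{k<n : \alpha_{\delta,k} \in A\}|}{n} \geq a.$$ *)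

theory Defs
  imports "HOL-Library.Extended_Real" "HOL-Library.Countable_Set_Type"
begin

unbundle cardinal_syntax

text \<open>
  The type of countable ordinals: the carrier of the cardinal successor of \<open>\<aleph>\<^sub>0\<close>,
  with its well-order.
\<close>

typedef omega1 = "Field (cardSuc natLeq)"
proof -
  have "infinite (Field (cardSuc natLeq))"
    using cardSuc_finite[OF natLeq_Card_order] by (simp add: Field_natLeq)
  then show ?thesis
    by (auto dest: infinite_imp_nonempty)
qed

instantiation omega1 :: wellorder
begin

definition less_eq_omega1 :: "omega1 \<Rightarrow> omega1 \<Rightarrow> bool"
  where "x \<le> y \<longleftrightarrow> (Rep_omega1 x, Rep_omega1 y) \<in> cardSuc natLeq"

definition less_omega1 :: "omega1 \<Rightarrow> omega1 \<Rightarrow> bool"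
  where "x < y \<longleftrightarrow> x \<le> y \<and> x \<noteq> (y :: omega1)"

instance
proof
  let ?r = "cardSuc natLeq"
  have W: "Well_order ?r"
    using cardSuc_Card_order[OF natLeq_Card_order] card_order_on_well_order_on by blast
  then have L: "Linear_order ?r" and wf: "wf (?r - Id)"
    by (simp_all add: well_order_on_def)
  then have R: "Refl ?r" and T: "trans ?r" and A: "antisym ?r" and Tot: "Total ?r"
    by (simp_all add: order_on_defs)
  fix x y z :: omega1
  show refl: "x \<le> x" for x :: omega1
    unfolding less_eq_omega1_def by (rule refl_onD[OF R Rep_omega1])
  show anti: "x = y" if "x \<le> y" "y \<le> x" for x y :: omega1
    using antisymD[OF A that[unfolded less_eq_omega1_def]] by (simp only: Rep_omega1_inject)
  show "x < y \<longleftrightarrow> x \<le> y \<and> \<not> y \<le> x"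
    using anti refl unfolding less_omega1_def by blast
  show "x \<le> z" if "x \<le> y" "y \<le> z"
    using that unfolding less_eq_omega1_def by (rule transD[OF T])
  show "x \<le> y \<or> y \<le> x"
  proof (cases "x = y")
    case True
    then show ?thesis by (simp add: refl)
  next
    case False
    then have "Rep_omega1 x \<noteq> Rep_omega1 y"
      by (simp add: Rep_omega1_inject)
    with Tot Rep_omega1[of x] Rep_omega1[of y] show ?thesis
      unfolding less_eq_omega1_def total_on_def by blast
  qed
  fix P :: "omega1 \<Rightarrow> bool" and a :: omega1
  assume step: "\<And>x. (\<And>y. y < x \<Longrightarrow> P y) \<Longrightarrow> P x"
  have "wf (inv_image (?r - Id) Rep_omega1)"
    using wf by (rule wf_inv_image)
  then show "P a"
  proof (induction a rule: wf_induct_rule)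
    case (less x)
    show ?case
      by (rule step, rule less)
        (simp add: less_omega1_def less_eq_omega1_def Rep_omega1_inject)
  qed
qed

end

text \<open>
  Up to isomorphism, \<open>\<omega>\<^sub>1\<close> is the unique uncountable well-order all of whose proper
  initial segments are countable.
\<close>

lemma uncountable_UNIV_omega1: "uncountable (UNIV :: omega1 set)"
proof
  assume "countable (UNIV :: omega1 set)"
  then have "countable (range Rep_omega1)"
    by simp
  then have "|Field (cardSuc natLeq)| \<le>o natLeq"
    by (simp add: countable_card_le_natLeq type_definition.Rep_range[OF type_definition_omega1])
  moreover have "|Field (cardSuc natLeq)| =o cardSuc natLeq"
    using cardSuc_Card_order[OF natLeq_Card_order] by (rule card_of_Field_ordIso)
  ultimately have "cardSuc natLeq \<le>o natLeq"
    using ordIso_ordLeq_trans ordIso_symmetric by blast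
  then show False
    using cardSuc_greater[OF natLeq_Card_order] not_ordLess_ordLeq by blast
qed

lemma countable_lessThan_omega1: "countable {..<x :: omega1}"
proof -
  let ?S = "underS (cardSuc natLeq) (Rep_omega1 x)"
  have "|?S| <o cardSuc natLeq"
    using cardSuc_Card_order[OF natLeq_Card_order] Rep_omega1 by (rule card_of_underS)
  then have "|?S| \<le>o natLeq"
    using cardSuc_ordLeq_ordLess[OF natLeq_Card_order card_of_Card_order] by blast
  then have "countable ?S"
    by (simp add: countable_card_le_natLeq)
  moreover have "Rep_omega1 ` {..<x} \<subseteq> ?S"
    by (auto simp: underS_def less_omega1_def less_eq_omega1_def Rep_omega1_inject)
  ultimately have "countable (Rep_omega1 ` {..<x})"
    by (rule countable_subset[rotated])
  then show ?thesis
    by (rule countable_image_inj_on) (simp add: inj_on_def Rep_omega1_inject)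
qed

unbundle no cardinal_syntax

text \<open>Zero is not a limit: no sequence is cofinal in it.\<close>

definition Lim_omega1 :: "omega1 set"
  where "Lim_omega1 = {\<delta>. (\<exists>\<beta>. \<beta> < \<delta>) \<and> (\<forall>\<beta><\<delta>. \<exists>\<gamma>. \<beta> < \<gamma> \<and> \<gamma> < \<delta>)}"

definition increasing_cofinal :: "(nat \<Rightarrow> omega1) \<Rightarrow> omega1 \<Rightarrow> bool"
  where "increasing_cofinal s \<delta> \<longleftrightarrow>
    strict_mono s \<and> (\<forall>n. s n < \<delta>) \<and> (\<forall>\<beta><\<delta>. \<exists>n. \<beta> \<le> s n)"

text \<open>
  Since \<open>\<alpha> \<delta>\<close> is strictly increasing, it is determined by \<open>A \<delta>\<close>. The values of \<open>A\<close> and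
  \<open>\<alpha>\<close> outside \<open>Lim_omega1\<close> are irrelevant.
\<close>

definition club_sup :: "real \<Rightarrow> bool"
  where "club_sup a \<longleftrightarrow>
    (\<exists>(A :: omega1 \<Rightarrow> omega1 set) (\<alpha> :: omega1 \<Rightarrow> nat \<Rightarrow> omega1).
      (\<forall>\<delta>\<in>Lim_omega1. A \<delta> = range (\<alpha> \<delta>) \<and> increasing_cofinal (\<alpha> \<delta>) \<delta>) \<and>
      (\<forall>X :: omega1 set. uncountable X \<longrightarrow>
        (\<exists>\<delta>\<in>Lim_omega1.
          limsup (\<lambda>n. ereal (real (card {k. k < n \<and> \<alpha> \<delta> k \<in> X}) / real n)) \<ge> ereal a)))"

end

theory Submission
  imports Defs
begin

text \<open>
  Let \<open>\<alpha>\<close> witness the principle for \<open>a\<close>. Call \<open>c\<close> a bound for an uncountable \<open>X\<close> if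
  \<open>X\<close> has upper density at most \<open>c\<close> along every \<open>\<alpha> \<delta>\<close>, and let \<open>i \<ge> a > 0\<close> be the infimum of all
  bounds of all uncountable sets. Choose \<open>Y\<close> with a bound \<open>c < i / b\<close>. As \<open>b * c < i\<close>, every uncountable
  \<open>Z \<subseteq> Y\<close> has upper density above \<open>b * c\<close> along some \<open>\<alpha> \<delta>\<close>, hence upper density at least \<open>b\<close> relative
  to \<open>Y\<close>. So the traces on \<open>Y\<close> of the sequences \<open>\<alpha> \<delta>\<close>, pulled back along an increasing map
  \<open>\<omega>\<^sub>1 \<rightarrow> Y\<close>, witness the principle for \<open>b\<close>.
\<close>

section \<open>Upper density of sets of natural numbers\<close>

definition upper_density :: "nat set \<Rightarrow> ereal"
  where "upper_density K = limsup (\<lambda>n. ereal (real (card {k. k < n \<and> k \<in> K}) / real n))"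

lemma club_sup_iff_upper_density:
  "club_sup a \<longleftrightarrow>
    (\<exists>\<alpha>. (\<forall>\<delta>\<in>Lim_omega1. increasing_cofinal (\<alpha> \<delta>) \<delta>) \<and>
      (\<forall>X. uncountable X \<longrightarrow> (\<exists>\<delta>\<in>Lim_omega1. ereal a \<le> upper_density (\<alpha> \<delta> -` X))))"
    (is "_ \<longleftrightarrow> (\<exists>\<alpha>. ?P \<alpha>)")
proof
  assume "\<exists>\<alpha>. ?P \<alpha>"
  then obtain \<alpha> where "?P \<alpha>" ..
  then show "club_sup a"
    unfolding club_sup_def upper_density_def vimage_eq
    by (intro exI[of _ "\<lambda>\<delta>. range (\<alpha> \<delta>)"] exI[of _ \<alpha>]) simp
next
  assume "club_sup a"
  then show "\<exists>\<alpha>. ?P \<alpha>"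
    unfolding club_sup_def upper_density_def vimage_eq by blast
qed

lemma upper_density_mono:
  assumes "K \<subseteq> L"
  shows "upper_density K \<le> upper_density L"
  unfolding upper_density_def
proof (rule Limsup_mono, rule always_eventually, rule allI)
  fix n :: nat
  have "card {k. k < n \<and> k \<in> K} \<le> card {k. k < n \<and> k \<in> L}"
    using assms by (intro card_mono) auto
  then show "ereal (real (card {k. k < n \<and> k \<in> K}) / real n) \<le>
      ereal (real (card {k. k < n \<and> k \<in> L}) / real n)"
    by (simp add: divide_right_mono)
qed

lemma upper_density_le_1: "upper_density K \<le> 1"
  unfolding upper_density_def
proof (rule Limsup_bounded, rule always_eventually, rule allI)
  fix n :: nat
  have "card {k. k < n \<and> k \<in> K} \<le> card {..<n}"
    by (rule card_mono) auto
  then show "ereal (real (card {k. k < n \<and> k \<in> K}) / real n) \<le> 1"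
    by (simp add: divide_le_eq one_ereal_def)
qed

section \<open>Relative upper density along an enumeration\<close>

lemma frequently_imp_le_Limsup:
  fixes f :: "'a \<Rightarrow> 'b :: complete_linorder"
  assumes "\<exists>\<^sub>F x in F. b \<le> f x"
  shows "b \<le> Limsup F f"
proof (rule ccontr)
  assume "\<not> b \<le> Limsup F f"
  then have "\<forall>\<^sub>F x in F. f x < b"
    by (intro Limsup_lessD) simp
  then show False
    using assms by (simp add: frequently_def not_le)
qed

lemma less_Limsup_imp_frequently:
  fixes f :: "'a \<Rightarrow> 'b :: complete_linorder"
  assumes "b < Limsup F f"
  shows "\<exists>\<^sub>F x in F. b < f x"
proof (rule ccontr)
  assume "\<not> (\<exists>\<^sub>F x in F. b < f x)"
  then have "Limsup F f \<le> b"
    by (intro Limsup_bounded) (simp add: frequently_def not_less)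
  then show False
    using assms by simp
qed

text \<open>As \<open>enumerate K\<close> increases with range \<open>K\<close>, the elements of
  \<open>K\<close> below \<open>n\<close> form an initial segment of the enumeration, whose length
  is their number.\<close>

lemma enumerate_image_lessThan_card:
  fixes K :: "nat set"
  assumes "infinite K"
  shows "enumerate K ` {..<card {k. k < n \<and> k \<in> K}} = {k. k < n \<and> k \<in> K}"
proof -
  define m where "m = (LEAST k. n \<le> enumerate K k)"
  have "n \<le> enumerate K m"
    unfolding m_def by (rule LeastI[of _ n]) (rule le_enumerate[OF assms])
  then have below: "enumerate K k < n \<longleftrightarrow> k < m" for k
    using not_less_Least[of k "\<lambda>k. n \<le> enumerate K k"] enumerate_mono_le_iff[OF assms, of m k]
    unfolding m_def by (meson leD leI order_trans)
  have "enumerate K ` {..<m} = {k. k < n \<and> k \<in> range (enumerate K)}"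
    using below by auto
  also have "range (enumerate K) = K"
    using bij_enumerate[OF assms] by (rule bij_betw_imp_surj_on)
  finally have image: "enumerate K ` {..<m} = {k. k < n \<and> k \<in> K}" .
  have "card (enumerate K ` {..<m}) = m"
    using inj_enumerate[OF assms] by (simp add: card_image inj_on_subset)
  with image show ?thesis
    by simp
qed

text \<open>Below suitable \<open>n\<close>, the proportion of \<open>L\<close> exceeds some
  \<open>q\<close> and that of \<open>K\<close> is less than \<open>q / b\<close>, so
  \<open>L\<close> takes up a share of at least \<open>b\<close> in \<open>K\<close>. That share is
  the density of the pulled-back \<open>L\<close> at the position that \<open>n\<close> has in
  \<open>K\<close>.\<close>

lemma upper_density_vimage_enumerate:
  assumes "L \<subseteq> K" and "upper_density K \<le> ereal c" and "ereal (b * c) < upper_density L"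
    and "0 < b" and "0 < c"
  shows "infinite K" and "ereal b \<le> upper_density (enumerate K -` L)"
proof -
  define count where "count M n = card {k. k < n \<and> k \<in> M}" for M :: "nat set" and n
  \<comment> \<open>The gap around \<open>q\<close> turns both limsup conditions into strict
    inequalities: an eventual one for \<open>K\<close>, a frequent one for \<open>L\<close>.\<close>
  obtain q where q: "b * c < q" "ereal q < upper_density L"
    using ereal_dense2[OF assms(3)] by auto
  have "c < q / b"
    using q(1) assms(4) by (simp add: field_simps)
  then have "upper_density K < ereal (q / b)"
    using assms(2) by (auto intro: order_le_less_trans)
  then have ev: "\<forall>\<^sub>F n in sequentially. ereal (real (count K n) / real n) < ereal (q / b)"
    unfolding upper_density_def count_def by (rule Limsup_lessD)
  have "\<exists>\<^sub>F n in sequentially. ereal q < ereal (real (count L n) / real n)"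
    using q(2) unfolding upper_density_def count_def by (rule less_Limsup_imp_frequently)
  from frequently_eventually_conj[OF this ev]
  have freq: "\<exists>\<^sub>F n in sequentially. real (count K n) / real n < q / b \<and>
      q < real (count L n) / real n"
    by (rule frequently_elim1) simp
  have "0 < q"
    using q(1) mult_pos_pos[OF assms(4,5)] by simp
  \<comment> \<open>The positions \<open>count K n\<close> have to be unbounded too. Since
    \<open>q * n < count L n \<le> count K n\<close>, any good \<open>n \<ge> N / q\<close> will
    do.\<close>
  have unbounded: "\<exists>n. N \<le> count K n \<and> b * real (count K n) \<le> real (count L n) \<and> 0 < count K n" for N
  proof -
    have "\<exists>\<^sub>F n in sequentially. nat \<lceil>real N / q\<rceil> \<le> n \<and>
        real (count K n) / real n < q / b \<and> q < real (count L n) / real n"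
      by (rule frequently_eventually_conj[OF freq eventually_ge_at_top])
    then obtain n where n: "real (count K n) / real n < q / b" "q < real (count L n) / real n"
        "nat \<lceil>real N / q\<rceil> \<le> n"
      by (auto dest: frequently_ex)
    have "0 < n"
      using n(2) \<open>0 < q\<close> by (cases n) auto
    have le: "count L n \<le> count K n"
      unfolding count_def using assms(1) by (intro card_mono) auto
    have L: "q * real n < real (count L n)"
      using n(2) \<open>0 < n\<close> by (simp add: field_simps)
    have "real N / q \<le> real n"
      using n(3) by linarith
    then have "real N \<le> q * real n"
      using \<open>0 < q\<close> by (simp add: field_simps)
    with L le have N: "N \<le> count K n"
      by linarith
    have "0 < q * real n"
      using \<open>0 < q\<close> \<open>0 < n\<close> by simp
    with L le have "0 < count K n"
      by linarith
    moreover have "b * real (count K n) < q * real n"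
      using n(1) \<open>0 < n\<close> \<open>0 < b\<close> by (simp add: field_simps)
    ultimately show ?thesis
      using N L by (intro exI[of _ n]) auto
  qed
  show inf: "infinite K"
  proof
    assume "finite K"
    then have "count K n \<le> card K" for n
      unfolding count_def by (intro card_mono) auto
    with unbounded[of "Suc (card K)"] show False
      by (meson not_less_eq_eq order_trans)
  qed
  have count_vimage: "count (enumerate K -` L) (count K n) = count L n" for n
  proof -
    have "enumerate K ` {k. k < count K n \<and> k \<in> enumerate K -` L} =
        enumerate K ` {..<count K n} \<inter> L"
      by auto
    also have "\<dots> = {k. k < n \<and> k \<in> L}"
      using enumerate_image_lessThan_card[OF inf, of n] assms(1) unfolding count_def by auto
    finally have "card (enumerate K ` {k. k < count K n \<and> k \<in> enumerate K -` L}) = count L n"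
      by (simp add: count_def)
    moreover have "inj_on (enumerate K) M" for M
      using inj_enumerate[OF inf] by (rule inj_on_subset) simp
    ultimately show ?thesis
      by (simp add: card_image count_def)
  qed
  show "ereal b \<le> upper_density (enumerate K -` L)"
    unfolding upper_density_def count_def[symmetric]
  proof (rule frequently_imp_le_Limsup, unfold frequently_sequentially, intro allI)
    fix N
    obtain n where "N \<le> count K n" "b * real (count K n) \<le> real (count L n)" "0 < count K n"
      using unbounded by blast
    then show "\<exists>m\<ge>N. ereal b \<le> ereal (real (count (enumerate K -` L) m) / real m)"
      by (intro exI[of _ "count K n"]) (simp add: count_vimage le_divide_eq)
  qed
qed

section \<open>Uncountable sets of countable ordinals\<close>

text \<open>Otherwise countably many countable initial segments would cover
  \<open>Y\<close>.\<close>

lemma uncountable_omega1_ex_greater: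
  fixes Y S :: "omega1 set"
  assumes "uncountable Y" and "countable S"
  shows "\<exists>y\<in>Y. \<forall>s\<in>S. s < y"
proof (rule ccontr)
  assume "\<not> ?thesis"
  then have "\<exists>s\<in>S. y = s \<or> y < s" if "y \<in> Y" for y
    using that by (metis linorder_neqE)
  then have "Y \<subseteq> (\<Union>s\<in>S. insert s {..<s})"
    by blast
  moreover have "countable (\<Union>s\<in>S. insert s {..<s})"
    using assms(2) countable_lessThan_omega1 by auto
  ultimately show False
    using assms(1) countable_subset by blast
qed

text \<open>By transfinite recursion, \<open>e \<beta>\<close> is chosen in \<open>Y\<close> above
  the countably many earlier values.\<close>

lemma uncountable_omega1_strict_mono:
  fixes Y :: "omega1 set"
  assumes "uncountable Y"
  obtains e :: "omega1 \<Rightarrow> omega1" where "strict_mono e" and "range e \<subseteq> Y"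
proof -
  define F :: "(omega1 \<Rightarrow> omega1) \<Rightarrow> omega1 \<Rightarrow> omega1"
    where "F f \<beta> = (SOME y. y \<in> Y \<and> (\<forall>\<gamma><\<beta>. f \<gamma> < y))" for f \<beta>
  define e where "e = wfrec {(x, y). x < y} F"
  have "adm_wf {(x, y). x < y} F"
    by (simp add: adm_wf_def F_def cong: conj_cong)
  then have e: "e \<beta> = F e \<beta>" for \<beta>
    unfolding e_def using wf by (metis wfrec_fixpoint)
  have "e \<beta> \<in> Y \<and> (\<forall>\<gamma><\<beta>. e \<gamma> < e \<beta>)" for \<beta>
  proof -
    have "\<exists>y. y \<in> Y \<and> (\<forall>\<gamma><\<beta>. e \<gamma> < y)"
      using uncountable_omega1_ex_greater[OF assms, of "e ` {..<\<beta>}"]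
      by (auto simp: countable_lessThan_omega1)
    then show ?thesis
      unfolding e[of \<beta>] F_def by (rule someI_ex)
  qed
  then show thesis
    by (intro that[of e]) (auto simp: strict_mono_def)
qed

section \<open>Transport of limit ordinals and sequences along an increasing map\<close>

text \<open>Once \<open>range e \<inter> {..<\<delta>}\<close> is cofinal in \<open>\<delta>\<close>, this says that \<open>\<delta>\<close> is the supremum of \<open>e ` {..<\<delta>'}\<close>.\<close>

definition corresponds :: "(omega1 \<Rightarrow> omega1) \<Rightarrow> omega1 \<Rightarrow> omega1 \<Rightarrow> bool"
  where "corresponds e \<delta> \<delta>' \<longleftrightarrow> (\<forall>\<beta>. e \<beta> < \<delta> \<longleftrightarrow> \<beta> < \<delta>')"

lemma infinite_trace_cofinal:
  assumes "increasing_cofinal s \<delta>" and "infinite (s -` Y)" and "\<beta> < \<delta>"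
  obtains n where "s n \<in> Y" and "\<beta> < s n"
proof -
  obtain m where "\<beta> \<le> s m"
    using assms(1,3) by (auto simp: increasing_cofinal_def)
  moreover obtain n where "m < n" "n \<in> s -` Y"
    using assms(2) unfolding infinite_nat_iff_unbounded by blast
  ultimately show thesis
    using assms(1) by (intro that[of n]) (auto simp: increasing_cofinal_def dest: strict_monoD)
qed

text \<open>Ensures that no two sequences are transported to the same \<open>\<delta>'\<close>. If
  the limits differed, the trace cofinal in the larger one would contain some
  \<open>e \<beta>\<close> strictly between them, and the two correspondences would disagree at
  \<open>\<beta>\<close>.\<close>

lemma corresponds_unique:
  assumes "corresponds e \<delta>\<^sub>1 \<delta>'" and "corresponds e \<delta>\<^sub>2 \<delta>'"
    and "increasing_cofinal s\<^sub>1 \<delta>\<^sub>1" and "infinite (s\<^sub>1 -` range e)"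
    and "increasing_cofinal s\<^sub>2 \<delta>\<^sub>2" and "infinite (s\<^sub>2 -` range e)"
  shows "\<delta>\<^sub>1 = \<delta>\<^sub>2"
proof -
  have le: "\<delta> \<le> \<delta>0"
    if c: "corresponds e \<delta> \<delta>'" "corresponds e \<delta>0 \<delta>'"
      and s: "increasing_cofinal s \<delta>" "infinite (s -` range e)" for \<delta> \<delta>0 s
  proof (rule ccontr)
    assume "\<not> \<delta> \<le> \<delta>0"
    then obtain n where n: "s n \<in> range e" "\<delta>0 < s n"
      using infinite_trace_cofinal[OF s, of \<delta>0] by (metis not_le)
    then obtain \<beta> where "s n = e \<beta>"
      by auto
    moreover have "s n < \<delta>"
      using s(1) by (simp add: increasing_cofinal_def)
    ultimately show False
      using c n(2) unfolding corresponds_def by (metis order_less_asym)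
  qed
  show ?thesis
    using le[OF assms(1,2,3,4)] le[OF assms(2,1,5,6)] by (rule order_antisym)
qed

text \<open>The least \<open>\<delta>'\<close> with \<open>\<delta> \<le> e \<delta>'\<close> works.
  It is a limit because the trace of \<open>s\<close> on \<open>range e\<close> is cofinal in
  \<open>\<delta>\<close>, so beyond each \<open>e \<beta> < \<delta>\<close> lies a further value
  of \<open>e\<close> below \<open>\<delta>\<close>.\<close>

lemma corresponds_ex:
  assumes "strict_mono e" and "increasing_cofinal s \<delta>" and "infinite (s -` range e)"
  obtains \<delta>' where "\<delta>' \<in> Lim_omega1" and "corresponds e \<delta> \<delta>'"
proof -
  define \<delta>' where "\<delta>' = (LEAST \<beta>. \<delta> \<le> e \<beta>)"
  have "uncountable (range e)"
    using uncountable_UNIV_omega1 strict_mono_imp_inj_on[OF assms(1)]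
    by (metis countable_image_inj_on)
  \<comment> \<open>Makes the \<open>LEAST\<close> meaningful: an uncountable range is
    unbounded.\<close>
  then obtain \<beta>\<^sub>0 where "\<delta> < e \<beta>\<^sub>0"
    using uncountable_omega1_ex_greater[of "range e" "{\<delta>}"] by auto
  then have "\<delta> \<le> e \<delta>'"
    unfolding \<delta>'_def by (intro LeastI[of "\<lambda>\<beta>. \<delta> \<le> e \<beta>" \<beta>\<^sub>0] less_imp_le)
  then have below: "e \<beta> < \<delta> \<longleftrightarrow> \<beta> < \<delta>'" for \<beta>
    using not_less_Least[of \<beta> "\<lambda>\<beta>. \<delta> \<le> e \<beta>"] strict_mono_less_eq[OF assms(1), of \<delta>' \<beta>]
    unfolding \<delta>'_def[symmetric] by (metis leD leI order_trans)
  have range: "\<exists>\<gamma>. s n = e \<gamma> \<and> \<gamma> < \<delta>'" if "s n \<in> range e" for n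
  proof -
    have "s n < \<delta>"
      using assms(2) by (simp add: increasing_cofinal_def)
    then show ?thesis
      using that below by auto
  qed
  have "\<exists>\<gamma>. \<beta> < \<gamma> \<and> \<gamma> < \<delta>'" if "\<beta> < \<delta>'" for \<beta>
  proof -
    have "e \<beta> < \<delta>"
      using that below by blast
    then obtain n where "s n \<in> range e" "e \<beta> < s n"
      using infinite_trace_cofinal[OF assms(2,3)] by blast
    then show ?thesis
      using range[of n] strict_mono_less[OF assms(1)] by metis
  qed
  moreover have "\<exists>\<beta>. \<beta> < \<delta>'"
    using range not_finite_existsD[OF assms(3)[unfolded vimage_def]] by blast
  ultimately show thesis
    using below by (intro that[of \<delta>']) (auto simp: Lim_omega1_def corresponds_def)
qed

text \<open>Applying \<open>e\<close> to the new sequence gives the subsequence of \<open>s\<close>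
  inside \<open>range e\<close>; since \<open>e\<close> preserves and reflects the order,
  monotonicity and cofinality carry over.\<close>

lemma increasing_cofinal_pullback:
  assumes "strict_mono e" and "increasing_cofinal s \<delta>" and "infinite (s -` range e)"
    and "corresponds e \<delta> \<delta>'"
  shows "increasing_cofinal (\<lambda>k. inv e (s (enumerate (s -` range e) k))) \<delta>'"
    (is "increasing_cofinal ?t \<delta>'")
proof -
  have et: "e (?t k) = s (enumerate (s -` range e) k)" for k
    using enumerate_in_set[OF assms(3), of k] by (simp add: f_inv_into_f)
  have "?t j < ?t k" if "j < k" for j k
  proof -
    have "e (?t j) < e (?t k)"
      unfolding et using assms(2) enumerate_mono[OF that assms(3)]
      by (auto simp: increasing_cofinal_def dest: strict_monoD)
    then show ?thesis
      using strict_mono_less[OF assms(1)] by blast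
  qed
  moreover have "?t k < \<delta>'" for k
    using assms(2,4) et[of k] unfolding corresponds_def increasing_cofinal_def by metis
  moreover have "\<exists>k. \<beta> \<le> ?t k" if "\<beta> < \<delta>'" for \<beta>
  proof -
    have "e \<beta> < \<delta>"
      using that assms(4) by (simp add: corresponds_def)
    then obtain n where n: "s n \<in> range e" "e \<beta> < s n"
      using infinite_trace_cofinal[OF assms(2,3)] by blast
    then obtain k where "enumerate (s -` range e) k = n"
      using enumerate_Ex[OF assms(3), of n] by auto
    then have "e \<beta> < e (?t k)"
      using n(2) unfolding et by simp
    then show ?thesis
      using strict_mono_less[OF assms(1)] by (meson less_imp_le)
  qed
  ultimately show ?thesis
    unfolding increasing_cofinal_def strict_mono_def by blast
qed

section \<open>Improving the density by an infimum argument\<close>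

lemma club_sup_improve:
  assumes "0 < a" and "0 < b" and "b < 1" and "club_sup a"
  shows "club_sup b"
proof -
  obtain \<alpha> where "\<forall>\<delta>\<in>Lim_omega1. increasing_cofinal (\<alpha> \<delta>) \<delta>"
    and guess: "\<forall>X. uncountable X \<longrightarrow> (\<exists>\<delta>\<in>Lim_omega1. ereal a \<le> upper_density (\<alpha> \<delta> -` X))"
    using assms(4) unfolding club_sup_iff_upper_density by (elim exE conjE)
  then have \<alpha>: "increasing_cofinal (\<alpha> \<delta>) \<delta>" if "\<delta> \<in> Lim_omega1" for \<delta>
    using that by blast
  define S where "S = {c. \<exists>X. uncountable X \<and>
    (\<forall>\<delta>\<in>Lim_omega1. upper_density (\<alpha> \<delta> -` X) \<le> ereal c)}"
  \<comment> \<open>The guessing property of \<open>\<alpha>\<close> enters only here, to keep the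
    infimum of \<open>S\<close> positive.\<close>
  have S_ge: "a \<le> c" if mem: "c \<in> S" for c
  proof -
    obtain X where "uncountable X" and X: "\<forall>\<delta>\<in>Lim_omega1. upper_density (\<alpha> \<delta> -` X) \<le> ereal c"
      using mem unfolding S_def by blast
    then obtain \<delta> where "\<delta> \<in> Lim_omega1" "ereal a \<le> upper_density (\<alpha> \<delta> -` X)"
      using guess by blast
    with X have "ereal a \<le> ereal c"
      using order_trans by blast
    then show ?thesis
      by simp
  qed
  have "1 \<in> S"
    unfolding S_def using uncountable_UNIV_omega1 upper_density_le_1
    by (auto simp: one_ereal_def[symmetric] intro!: exI[of _ UNIV])
  have bdd: "bdd_below S"
    using S_ge by (rule bdd_belowI)
  have "a \<le> Inf S"
    using \<open>1 \<in> S\<close> S_ge by (intro cInf_greatest) auto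
  \<comment> \<open>Strict because the infimum is positive and \<open>b < 1\<close>; this leaves
    room for \<open>c\<close>.\<close>
  with assms have "Inf S < Inf S / b"
    by (simp add: less_divide_eq)
  then obtain c where c: "c \<in> S" "c < Inf S / b"
    using \<open>1 \<in> S\<close> by (metis cInf_less_iff bdd empty_iff)
  have "0 < c"
    using S_ge[OF c(1)] assms(1) by simp
  have "b * c < Inf S"
    using c(2) assms(2) by (simp add: field_simps)
  \<comment> \<open>So every uncountable set has upper density above \<open>b * c\<close> along some
    \<open>\<alpha> \<delta>\<close>. This will be applied to the sets \<open>e\<close> followed by
    an image argument \<open>X\<close>.\<close>
  then have "b * c \<notin> S"
    using cInf_lower[OF _ bdd] by fastforce
  obtain Y where Y: "uncountable Y" "\<And>\<delta>. \<delta> \<in> Lim_omega1 \<Longrightarrow> upper_density (\<alpha> \<delta> -` Y) \<le> ereal c"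
    using c(1) unfolding S_def by blast
  obtain e :: "omega1 \<Rightarrow> omega1" where e: "strict_mono e" "range e \<subseteq> Y"
    using uncountable_omega1_strict_mono[OF Y(1)] .
  have inj: "inj e"
    using e(1) by (rule strict_mono_imp_inj_on)
  have unc: "uncountable (e ` X)" if "uncountable X" for X
    using that inj by (metis countable_image_inj_on inj_on_subset subset_UNIV)
  have range_le: "upper_density (\<alpha> \<delta> -` range e) \<le> ereal c" if "\<delta> \<in> Lim_omega1" for \<delta>
    using upper_density_mono[OF vimage_mono[OF e(2)]] Y(2)[OF that] by (rule order_trans)
  define P where "P \<delta>' \<delta> \<longleftrightarrow> \<delta> \<in> Lim_omega1 \<and> infinite (\<alpha> \<delta> -` range e) \<and> corresponds e \<delta> \<delta>'" for \<delta>' \<delta>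
  \<comment> \<open>Where nothing is transported to \<open>\<delta>'\<close>, the old sequence
    serves as a filler that is still increasing and cofinal.\<close>
  define \<alpha>' where "\<alpha>' \<delta>' = (if \<exists>\<delta>. P \<delta>' \<delta>
    then let s = \<alpha> (SOME \<delta>. P \<delta>' \<delta>) in (\<lambda>k. inv e (s (enumerate (s -` range e) k)))
    else \<alpha> \<delta>')" for \<delta>'
  have \<alpha>'_eq: "\<alpha>' \<delta>' = (\<lambda>k. inv e (\<alpha> \<delta> (enumerate (\<alpha> \<delta> -` range e) k)))" if "P \<delta>' \<delta>" for \<delta>' \<delta>
  proof -
    have "P \<delta>' (SOME \<delta>. P \<delta>' \<delta>)"
      using that by (rule someI)
    then have "(SOME \<delta>. P \<delta>' \<delta>) = \<delta>"
      using that \<alpha> unfolding P_def by (blast intro: corresponds_unique)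
    then show ?thesis
      using that by (auto simp: \<alpha>'_def Let_def)
  qed
  have "increasing_cofinal (\<alpha>' \<delta>') \<delta>'" if "\<delta>' \<in> Lim_omega1" for \<delta>'
  proof (cases "\<exists>\<delta>. P \<delta>' \<delta>")
    case True
    then obtain \<delta> where "P \<delta>' \<delta>" by blast
    then show ?thesis
      using increasing_cofinal_pullback[OF e(1) \<alpha>] unfolding \<alpha>'_eq[OF \<open>P \<delta>' \<delta>\<close>] P_def by blast
  next
    case False
    then show ?thesis
      using \<alpha>[OF that] by (simp add: \<alpha>'_def)
  qed
  moreover have "\<exists>\<delta>'\<in>Lim_omega1. ereal b \<le> upper_density (\<alpha>' \<delta>' -` X)" if X: "uncountable X" for X
  proof -
    obtain \<delta> where \<delta>: "\<delta> \<in> Lim_omega1" "ereal (b * c) < upper_density (\<alpha> \<delta> -` (e ` X))"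
      using \<open>b * c \<notin> S\<close> unc[OF X] unfolding S_def by (auto simp: not_le)
    have sub: "\<alpha> \<delta> -` (e ` X) \<subseteq> \<alpha> \<delta> -` range e"
      by auto
    note dens = upper_density_vimage_enumerate[OF sub range_le[OF \<delta>(1)] \<delta>(2) assms(2) \<open>0 < c\<close>]
    obtain \<delta>' where \<delta>': "\<delta>' \<in> Lim_omega1" "corresponds e \<delta> \<delta>'"
      using corresponds_ex[OF e(1) \<alpha>[OF \<delta>(1)] dens(1)] .
    have "P \<delta>' \<delta>"
      using \<delta>(1) \<delta>'(2) dens(1) by (simp add: P_def)
    \<comment> \<open>By injectivity of \<open>e\<close>, the visits of
      \<open>\<alpha>' \<delta>'\<close> to \<open>X\<close> are the visits of
      \<open>\<alpha> \<delta>\<close> to the image of \<open>X\<close>, renumbered within the trace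
      on \<open>range e\<close>. Their upper density is thus the relative one bounded in
      \<open>dens\<close>.\<close>
    have trace: "\<alpha>' \<delta>' -` X = enumerate (\<alpha> \<delta> -` range e) -` (\<alpha> \<delta> -` (e ` X))"
    proof -
      have "inv e y \<in> X \<longleftrightarrow> y \<in> e ` X" if "y \<in> range e" for y
        using that inj by auto
      then show ?thesis
        using enumerate_in_set[OF dens(1)] unfolding \<alpha>'_eq[OF \<open>P \<delta>' \<delta>\<close>] by auto
    qed
    show ?thesis
      using dens(2)[folded trace] \<delta>'(1) by (rule bexI)
  qed
  ultimately show ?thesis
    unfolding club_sup_iff_upper_density by blast
qed

theorem theorem1p4:
  fixes a b :: real
  assumes "a \<in> {0<..<1}" and "b \<in> {0<..<1}"
  shows "club_sup a \<longleftrightarrow> club_sup b"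
  using assms club_sup_improve[of a b] club_sup_improve[of b a] by auto

end
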